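(* Let $p\in[1,\infty]$ and let $L(\mathbb{R})$ be the set of Lebesgue integrable real functions on $\mathbb{R}$, with functions equal almost everywhere identified. Define $d^p:L(\mathbb{R})\times L(\mathbb{R})\to\mathbb{R}$ by $$d^p(f,g)=\Big(\big(\int (f-g)^+\,dx\big)^p+\big(\int (f-g)^-\,dx\big)^p\Big)^{1/p}$$ (for $p=\infty$, $d^\infty(f,g)$ is the maximum of the two integrals). Then $(L(\mathbb{R}),d^p)$ is a metric space.
   Context: For a real function $f$, $f^+=\max(f,0)$ and $f^-=\max(-f,0)$. Integrals are over $\mathbb{R}$ with respect to Lebesgue measure. *)

theory Defs
  imports "HOL-Analysis.Analysis"
begin

text \<open>
  The space \<open>L(\<real>)\<close> of Lebesgue integrable real functions on the real line, modulo equality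
  almost everywhere.  The relation is partial: only integrable functions are related to themselves.
\<close>

quotient_type L_space = "real \<Rightarrow> real" / partial:
  "\<lambda>f g. integrable lebesgue f \<and> integrable lebesgue g \<and> (AE x in lebesgue. f x = g x)"
proof (rule part_equivpI)
  show "\<exists>f. integrable lebesgue f \<and> integrable lebesgue f \<and> (AE x in lebesgue. f x = (f x :: real))"
    by (rule exI[of _ "\<lambda>x. 0"]) simp
  show "symp (\<lambda>f g. integrable lebesgue f \<and> integrable lebesgue g \<and>
      (AE x in lebesgue. f x = (g x :: real)))"
    by (auto intro!: sympI)
  show "transp (\<lambda>f g. integrable lebesgue f \<and> integrable lebesgue g \<and>
      (AE x in lebesgue. f x = (g x :: real)))"
    by (rule transpI) (auto elim: AE_mp)
qed

definition int_pos :: "(real \<Rightarrow> real) \<Rightarrow> real" where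
  "int_pos h = (LINT x|lebesgue. max (h x) 0)"

definition int_neg :: "(real \<Rightarrow> real) \<Rightarrow> real" where
  "int_neg h = (LINT x|lebesgue. max (- h x) 0)"

text \<open>
  The exponent ranges over the extended reals; only \<open>1 \<le> p\<close> is meaningful below.
  Both integrals are nonnegative, and \<open>0 powr a = 0\<close>, so \<open>powr\<close> is the usual power here.
\<close>

definition dist_fun :: "ereal \<Rightarrow> (real \<Rightarrow> real) \<Rightarrow> (real \<Rightarrow> real) \<Rightarrow> real" where
  "dist_fun p f g =
     (let a = int_pos (\<lambda>x. f x - g x); b = int_neg (\<lambda>x. f x - g x) in
      if p = \<infinity> then max a b
      else (a powr real_of_ereal p + b powr real_of_ereal p) powr (1 / real_of_ereal p))"

lemma int_pos_cong_AE:
  assumes "integrable lebesgue h" "integrable lebesgue k" "AE x in lebesgue. h x = k x"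
  shows "int_pos h = int_pos k"
  unfolding int_pos_def
proof (rule integral_cong_AE)
  show "(\<lambda>x. max (h x) 0) \<in> borel_measurable lebesgue"
    using borel_measurable_integrable[OF assms(1)] by (intro borel_measurable_max) simp_all
  show "(\<lambda>x. max (k x) 0) \<in> borel_measurable lebesgue"
    using borel_measurable_integrable[OF assms(2)] by (intro borel_measurable_max) simp_all
  show "AE x in lebesgue. max (h x) 0 = max (k x) 0"
    using assms(3) by (rule AE_mp) simp
qed

lemma int_neg_cong_AE:
  assumes "integrable lebesgue h" "integrable lebesgue k" "AE x in lebesgue. h x = k x"
  shows "int_neg h = int_neg k"
proof -
  have "int_neg h = int_pos (\<lambda>x. - h x)" "int_neg k = int_pos (\<lambda>x. - k x)"
    by (simp_all add: int_neg_def int_pos_def)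
  moreover have "AE x in lebesgue. - h x = - k x"
    using assms(3) by (rule AE_mp) simp
  ultimately show ?thesis
    using int_pos_cong_AE[of "\<lambda>x. - h x" "\<lambda>x. - k x"] assms(1,2) by simp
qed

lift_definition dist_L :: "ereal \<Rightarrow> L_space \<Rightarrow> L_space \<Rightarrow> real" is dist_fun
proof -
  fix p :: ereal and f f' g g' :: "real \<Rightarrow> real"
  assume f: "integrable lebesgue f \<and> integrable lebesgue f' \<and> (AE x in lebesgue. f x = f' x)"
    and g: "integrable lebesgue g \<and> integrable lebesgue g' \<and> (AE x in lebesgue. g x = g' x)"
  have "AE x in lebesgue. f x - g x = f' x - g' x"
    using conjunct2[OF conjunct2[OF f]] conjunct2[OF conjunct2[OF g]] by eventually_elim simp
  then show "dist_fun p f g = dist_fun p f' g'"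
    using f g int_pos_cong_AE[of "\<lambda>x. f x - g x" "\<lambda>x. f' x - g' x"]
      int_neg_cong_AE[of "\<lambda>x. f x - g x" "\<lambda>x. f' x - g' x"]
    by (simp add: dist_fun_def)
qed

end

theory Submission imports Defs begin

text \<open>
  The distance is the \<open>\<ell>\<^sup>p\<close> norm on \<open>\<real>\<^sup>2\<close> of the pair formed by the positive and the negative part
  integral of \<open>f - g\<close>. Both integrals are subadditive in \<open>f - g\<close>, so monotonicity of the norm on the
  positive quadrant and Minkowski's inequality for pairs give the triangle inequality. Minkowski's
  inequality follows from convexity of \<open>x \<mapsto> x\<^sup>p\<close>, applied to each coordinate of the convex combination
  of the two normalized pairs.
\<close>

text \<open>This is the norm only on nonnegative pairs, as no absolute values are taken.\<close>

definition pair_norm :: "ereal \<Rightarrow> real \<Rightarrow> real \<Rightarrow> real" where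
  "pair_norm p a b =
     (if p = \<infinity> then max a b
      else (a powr real_of_ereal p + b powr real_of_ereal p) powr (1 / real_of_ereal p))"

lemma dist_fun_eq_pair_norm:
  "dist_fun p f g = pair_norm p (int_pos (\<lambda>x. f x - g x)) (int_neg (\<lambda>x. f x - g x))"
  by (simp add: dist_fun_def pair_norm_def Let_def)

lemma real_of_ereal_ge_1:
  assumes "1 \<le> p" "p \<noteq> \<infinity>"
  shows "1 \<le> real_of_ereal p"
  using assms by (cases p) auto

lemma pair_norm_nonneg:
  assumes "0 \<le> a"
  shows "0 \<le> pair_norm p a b"
  using assms by (simp add: pair_norm_def le_max_iff_disj)

lemma pair_norm_commute: "pair_norm p a b = pair_norm p b a"
  by (simp add: pair_norm_def add.commute max.commute)

lemma pair_norm_mono: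
  assumes "1 \<le> p" "0 \<le> a" "a \<le> a'" "0 \<le> b" "b \<le> b'"
  shows "pair_norm p a b \<le> pair_norm p a' b'"
proof (cases "p = \<infinity>")
  case True
  then show ?thesis using assms by (auto simp: pair_norm_def)
next
  case False
  then have "1 \<le> real_of_ereal p" using assms real_of_ereal_ge_1 by blast
  then show ?thesis
    using False assms by (auto simp: pair_norm_def intro!: powr_mono2 add_mono)
qed

lemma pair_norm_eq_0_iff:
  assumes "1 \<le> p" "0 \<le> a" "0 \<le> b"
  shows "pair_norm p a b = 0 \<longleftrightarrow> a = 0 \<and> b = 0"
proof (cases "p = \<infinity>")
  case True
  then show ?thesis using assms by (auto simp: pair_norm_def)
next
  case False
  then show ?thesis
    using assms by (auto simp: pair_norm_def add_nonneg_eq_0_iff)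
qed

text \<open>Raising to the power \<open>p\<close> undoes the root, so Minkowski's inequality can be
  argued with sums of powers.\<close>

lemma powr_pair_norm:
  assumes "1 \<le> p" "p \<noteq> \<infinity>"
  shows "pair_norm p a b powr real_of_ereal p = a powr real_of_ereal p + b powr real_of_ereal p"
  using assms real_of_ereal_ge_1[OF assms] by (simp add: pair_norm_def powr_powr)

text \<open>The endpoint 0 is included because a coordinate of a nonzero pair may vanish.\<close>

lemma convex_on_powr_atLeast_0:
  fixes q :: real
  assumes "1 \<le> q"
  shows "convex_on {0..} (\<lambda>x. x powr q)"
proof (rule convex_onI)
  fix t x y :: real
  assume t: "0 < t" "t < 1" and xy: "x \<in> {0..}" "y \<in> {0..}"
  \<comment> \<open>If one of the two points is 0, convexity reduces to this bound, which comes from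
    \<open>s powr q \<le> s\<close> for \<open>s\<close> between 0 and 1.\<close>
  have scale: "(s * z) powr q \<le> s * z powr q" if "0 < s" "s < 1" "0 \<le> z" for s z :: real
    using that powr_le_one_le[of s q] assms by (simp add: powr_mult mult_right_mono)
  consider "x = 0" | "y = 0" | "0 < x" "0 < y"
    using xy by fastforce
  then show "((1 - t) *\<^sub>R x + t *\<^sub>R y) powr q \<le> (1 - t) * x powr q + t * y powr q"
  proof cases
    case 1
    then show ?thesis using scale[of t y] t xy by simp
  next
    case 2
    then show ?thesis using scale[of "1 - t" x] t xy by simp
  next
    case 3
    then show ?thesis using convex_onD[OF powr_convex[OF assms], of t x y] t by simp
  qed
qed simp

text \<open>One coordinate of Minkowski's inequality, with \<open>S\<close> and \<open>T\<close>
  standing for the norms of the two pairs: \<open>(a + c) / (S + T)\<close> is the convex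
  combination of \<open>a / S\<close> and \<open>c / T\<close> with weights
  \<open>S / (S + T)\<close> and \<open>T / (S + T)\<close>.\<close>

lemma powr_add_le_convex_combination:
  fixes q :: real
  assumes "1 \<le> q" "0 \<le> a" "0 \<le> c" "0 < S" "0 < T"
  shows "((a + c) / (S + T)) powr q
    \<le> S / (S + T) * (a powr q / S powr q) + T / (S + T) * (c powr q / T powr q)"
proof -
  from convex_onD[OF convex_on_powr_atLeast_0, of q "T / (S + T)" "a / S" "c / T"] assms
  have "((1 - T / (S + T)) * (a / S) + T / (S + T) * (c / T)) powr q
    \<le> (1 - T / (S + T)) * (a / S) powr q + T / (S + T) * (c / T) powr q"
    by simp
  moreover have "1 - T / (S + T) = S / (S + T)"
    using assms by (simp add: field_simps)
  moreover have "S / (S + T) * (a / S) + T / (S + T) * (c / T) = (a + c) / (S + T)"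
    using assms by (simp add: add_divide_distrib)
  ultimately show ?thesis
    using assms by (simp add: powr_divide)
qed

lemma pair_norm_triangle:
  assumes "1 \<le> p" "0 \<le> a" "0 \<le> b" "0 \<le> c" "0 \<le> d"
  shows "pair_norm p (a + c) (b + d) \<le> pair_norm p a b + pair_norm p c d"
proof (cases "p = \<infinity>")
  case True
  then show ?thesis by (auto simp: pair_norm_def)
next
  case False
  define q where "q = real_of_ereal p"
  define S T where "S = pair_norm p a b" and "T = pair_norm p c d"
  have q: "1 \<le> q" using False assms real_of_ereal_ge_1 q_def by blast
  have S: "S powr q = a powr q + b powr q" and T: "T powr q = c powr q + d powr q"
    using powr_pair_norm[OF assms(1) False] by (simp_all add: S_def T_def q_def)
  show ?thesis
  \<comment> \<open>A pair of norm 0 cannot be normalized, but its entries are both 0 and the claim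
    becomes trivial.\<close>
  proof (cases "S = 0 \<or> T = 0")
    case True
    then show ?thesis
      using assms by (auto simp: S_def T_def pair_norm_eq_0_iff pair_norm_nonneg)
  next
    case False
    then have pos: "0 < S" "0 < T"
      using assms pair_norm_nonneg[of a p b] pair_norm_nonneg[of c p d]
      by (auto simp: S_def T_def)
    then have pow: "0 < S powr q" "0 < T powr q" by auto
    have "((a + c) / (S + T)) powr q + ((b + d) / (S + T)) powr q
      \<le> S / (S + T) * ((a powr q + b powr q) / S powr q)
        + T / (S + T) * ((c powr q + d powr q) / T powr q)"
      using powr_add_le_convex_combination[OF q assms(2,4) pos]
        powr_add_le_convex_combination[OF q assms(3,5) pos]
      by (simp add: add_divide_distrib distrib_left)
    \<comment> \<open>Both normalized pairs have power sum 1, so only the sum of the weights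
      remains.\<close>
    also have "\<dots> = 1"
      using pos pow by (simp flip: S T add: add_divide_distrib[symmetric])
    finally have "(a + c) powr q + (b + d) powr q \<le> (S + T) powr q"
      using pos assms by (simp add: powr_divide add_divide_distrib[symmetric])
    then have "((a + c) powr q + (b + d) powr q) powr (1 / q) \<le> ((S + T) powr q) powr (1 / q)"
      using q by (intro powr_mono2) auto
    also have "\<dots> = S + T"
      using q pos by (simp add: powr_powr)
    finally show ?thesis
      using \<open>p \<noteq> \<infinity>\<close> by (simp add: pair_norm_def S_def T_def q_def)
  qed
qed

text \<open>Facts about \<open>int_pos\<close> now serve for both integrals. For
  \<open>h = f - g\<close> the negation exchanges \<open>f\<close> and \<open>g\<close>, so symmetry
  of the distance is \<open>pair_norm_commute\<close>.\<close>

lemma int_neg_eq_int_pos: "int_neg h = int_pos (\<lambda>x. - h x)"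
  by (simp add: int_neg_def int_pos_def)

lemma int_pos_nonneg: "0 \<le> int_pos h"
  by (simp add: int_pos_def)

text \<open>The positive part is subadditive pointwise.\<close>

lemma int_pos_add_le:
  assumes "integrable lebesgue h" "integrable lebesgue k"
  shows "int_pos (\<lambda>x. h x + k x) \<le> int_pos h + int_pos k"
proof -
  have "int_pos (\<lambda>x. h x + k x) \<le> (LINT x|lebesgue. max (h x) 0 + max (k x) 0)"
    unfolding int_pos_def using assms by (intro integral_mono) auto
  also have "\<dots> = int_pos h + int_pos k"
    unfolding int_pos_def using assms by (intro Bochner_Integration.integral_add) auto
  finally show ?thesis .
qed

lemma int_pos_eq_0_iff:
  assumes "integrable lebesgue h"
  shows "int_pos h = 0 \<longleftrightarrow> (AE x in lebesgue. h x \<le> 0)"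
proof -
  have "int_pos h = 0 \<longleftrightarrow> (AE x in lebesgue. max (h x) 0 = 0)"
    unfolding int_pos_def using assms by (intro integral_nonneg_eq_0_iff_AE) auto
  then show ?thesis by (simp add: max_def)
qed

lemma dist_fun_nonneg: "0 \<le> dist_fun p f g"
  by (simp add: dist_fun_eq_pair_norm pair_norm_nonneg int_pos_nonneg)

lemma dist_fun_commute: "dist_fun p f g = dist_fun p g f"
  by (simp add: dist_fun_eq_pair_norm int_neg_eq_int_pos pair_norm_commute)

lemma dist_fun_eq_0_iff:
  assumes "1 \<le> p" "integrable lebesgue f" "integrable lebesgue g"
  shows "dist_fun p f g = 0 \<longleftrightarrow> (AE x in lebesgue. f x = g x)"
proof -
  have "dist_fun p f g = 0 \<longleftrightarrow>
    (AE x in lebesgue. f x - g x \<le> 0) \<and> (AE x in lebesgue. g x - f x \<le> 0)"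
    using assms
    by (simp add: dist_fun_eq_pair_norm int_neg_eq_int_pos pair_norm_eq_0_iff
        int_pos_nonneg int_pos_eq_0_iff)
  also have "\<dots> \<longleftrightarrow> (AE x in lebesgue. f x = g x)"
    by (simp add: eq_iff)
  finally show ?thesis .
qed

lemma dist_fun_triangle:
  assumes "1 \<le> p" "integrable lebesgue f" "integrable lebesgue g" "integrable lebesgue h"
  shows "dist_fun p f h \<le> dist_fun p f g + dist_fun p g h"
proof -
  have "int_pos (\<lambda>x. f x - h x) \<le> int_pos (\<lambda>x. f x - g x) + int_pos (\<lambda>x. g x - h x)"
    using int_pos_add_le[of "\<lambda>x. f x - g x" "\<lambda>x. g x - h x"] assms by simp
  \<comment> \<open>The negative parts, written as positive parts of the reversed
    differences.\<close>
  moreover have "int_pos (\<lambda>x. h x - f x) \<le> int_pos (\<lambda>x. g x - f x) + int_pos (\<lambda>x. h x - g x)"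
    using int_pos_add_le[of "\<lambda>x. g x - f x" "\<lambda>x. h x - g x"] assms by simp
  ultimately have "dist_fun p f h \<le> pair_norm p
      (int_pos (\<lambda>x. f x - g x) + int_pos (\<lambda>x. g x - h x))
      (int_pos (\<lambda>x. g x - f x) + int_pos (\<lambda>x. h x - g x))"
    using assms by (simp add: dist_fun_eq_pair_norm int_neg_eq_int_pos pair_norm_mono int_pos_nonneg)
  also have "\<dots> \<le> dist_fun p f g + dist_fun p g h"
    using assms
    by (simp add: dist_fun_eq_pair_norm int_neg_eq_int_pos pair_norm_triangle int_pos_nonneg)
  finally show ?thesis .
qed

theorem theorem3p5:
  fixes p :: ereal
  assumes "1 \<le> p"
  shows "Metric_space (UNIV :: L_space set) (dist_L p)"
proof
  fix F G H :: L_space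
  show "0 \<le> dist_L p F G"
    by transfer (rule dist_fun_nonneg)
  show "dist_L p F G = dist_L p G F"
    by transfer (rule dist_fun_commute)
  \<comment> \<open>Transfer turns equality of classes into almost everywhere equality of integrable
    representatives.\<close>
  show "dist_L p F G = 0 \<longleftrightarrow> F = G"
    using assms by transfer (simp add: dist_fun_eq_0_iff)
  show "dist_L p F H \<le> dist_L p F G + dist_L p G H"
    using assms by transfer (simp add: dist_fun_triangle)
qed

end
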